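(* If $X$ is a $T_4$ space then $\mathcal{M}(B_1(X))$ and $\mathcal{M}(B_1^*(X))$ are homeomorphic.
   Context: A $T_4$ space is a normal $T_1$ space. $B_1(X)$ is the ring of Baire one functions on $X$, i.e. pointwise limits of sequences of continuous functions $X\to\mathbb{R}$; $B_1^*(X)$ is its subring of bounded functions. For a commutative ring $R$ with unity, $\mathcal{M}(R)$ (the structure space of $R$) is the set of all maximal ideals of $R$ with the hull-kernel topology: the sets $\{M\in\mathcal{M}(R): a\in M\}$, $a\in R$, form a base for closed sets. *)

theory Defs
  imports "HOL-Analysis.Analysis" "HOL-Algebra.Ideal"
begin

definition baire_one :: "'a topology \<Rightarrow> ('a \<Rightarrow> real) \<Rightarrow> bool" where
  "baire_one X f \<longleftrightarrow>
    (\<exists>g. (\<forall>n::nat. continuous_map X euclideanreal (g n)) \<and>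
         (\<forall>x\<in>topspace X. (\<lambda>n. g n x) \<longlonglongrightarrow> f x))"

text \<open>Functions on the space are represented by HOL functions that are extensional on
  \<^term>\<open>topspace X\<close>, so that equality of ring elements is equality of functions on the space.\<close>

definition baire_one_ring :: "'a topology \<Rightarrow> ('a \<Rightarrow> real) ring" where
  "baire_one_ring X =
    \<lparr>carrier = {f \<in> extensional (topspace X). baire_one X f},
     mult = (\<lambda>f g. \<lambda>x\<in>topspace X. f x * g x),
     one = (\<lambda>x\<in>topspace X. 1),
     zero = (\<lambda>x\<in>topspace X. 0),
     add = (\<lambda>f g. \<lambda>x\<in>topspace X. f x + g x)\<rparr>"

definition bounded_baire_one_ring :: "'a topology \<Rightarrow> ('a \<Rightarrow> real) ring" where
  "bounded_baire_one_ring X =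
    (baire_one_ring X)
      \<lparr>carrier := {f \<in> carrier (baire_one_ring X). bounded (f ` topspace X)}\<rparr>"

definition maximal_ideals :: "('a, 'b) ring_scheme \<Rightarrow> 'a set set" where
  "maximal_ideals R = {M. maximalideal M R}"

text \<open>The hull-kernel topology, given by the base of open sets complementary to the basic closed
  sets \<open>{M. a \<in> M}\<close>. For commutative rings these do form a base; see \<open>closedin_structure_space\<close>.\<close>

definition structure_space :: "('a, 'b) ring_scheme \<Rightarrow> 'a set topology" where
  "structure_space R =
    topology (arbitrary union_of
      (\<lambda>U. \<exists>a\<in>carrier R. U = maximal_ideals R - {M \<in> maximal_ideals R. a \<in> M}))"

lemma openin_structure_space:
  fixes R (structure)
  assumes "cring R"
  shows "openin (structure_space R) U \<longleftrightarrow>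
    (\<exists>A\<subseteq>carrier R. U = (\<Union>a\<in>A. maximal_ideals R - {M \<in> maximal_ideals R. a \<in> M}))"
proof -
  interpret cring R by fact
  define D where "D = (\<lambda>a. maximal_ideals R - {M \<in> maximal_ideals R. a \<in> M})"
  have inter: "D a \<inter> D b = D (a \<otimes> b)" if ab: "a \<in> carrier R" "b \<in> carrier R" for a b
  proof -
    have "a \<otimes> b \<in> M \<longleftrightarrow> a \<in> M \<or> b \<in> M" if "maximalideal M R" for M
    proof -
      interpret M: primeideal M R using maximalideal_prime[OF that] .
      show ?thesis
        using M.I_prime[OF ab] M.I_l_closed[OF _ ab(1)] M.I_r_closed[OF _ ab(2)] by blast
    qed
    then show ?thesis by (auto simp: D_def maximal_ideals_def)
  qed
  have top: "istopology (arbitrary union_of (\<lambda>U. \<exists>a\<in>carrier R. U = D a))"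
  proof (rule istopology_base)
    fix S T assume "\<exists>a\<in>carrier R. S = D a" "\<exists>a\<in>carrier R. T = D a"
    then show "\<exists>a\<in>carrier R. S \<inter> T = D a" using inter by (metis m_closed)
  qed
  have "openin (structure_space R) U \<longleftrightarrow> (arbitrary union_of (\<lambda>U. \<exists>a\<in>carrier R. U = D a)) U"
    using topology_inverse'[OF top] unfolding structure_space_def D_def by simp
  also have "\<dots> \<longleftrightarrow> (\<exists>A\<subseteq>carrier R. U = (\<Union>a\<in>A. D a))"
  proof
    assume "(arbitrary union_of (\<lambda>U. \<exists>a\<in>carrier R. U = D a)) U"
    then obtain \<U> where "\<U> \<subseteq> D ` carrier R" "\<Union>\<U> = U"
      unfolding union_of_def arbitrary_def by blast
    then show "\<exists>A\<subseteq>carrier R. U = (\<Union>a\<in>A. D a)" by (metis subset_image_iff)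
  next
    assume "\<exists>A\<subseteq>carrier R. U = (\<Union>a\<in>A. D a)"
    then obtain A where "A \<subseteq> carrier R" "U = \<Union>(D ` A)" by blast
    then show "(arbitrary union_of (\<lambda>U. \<exists>a\<in>carrier R. U = D a)) U"
      unfolding union_of_def arbitrary_def by (intro exI[of _ "D ` A"]) auto
  qed
  finally show ?thesis unfolding D_def .
qed

lemma topspace_structure_space:
  fixes R (structure)
  assumes "cring R"
  shows "topspace (structure_space R) = maximal_ideals R"
proof
  interpret cring R by fact
  show "topspace (structure_space R) \<subseteq> maximal_ideals R"
    using openin_topspace[of "structure_space R"]
    unfolding openin_structure_space[OF assms] by blast
  have "\<one> \<notin> M" if "maximalideal M R" for M
  proof -
    interpret M: maximalideal M R by fact
    show ?thesis using M.I_notcarr M.one_imp_carrier by blast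
  qed
  then have "maximal_ideals R = (\<Union>a\<in>{\<one>}. maximal_ideals R - {M \<in> maximal_ideals R. a \<in> M})"
    by (auto simp: maximal_ideals_def)
  then have "openin (structure_space R) (maximal_ideals R)"
    unfolding openin_structure_space[OF assms] by (intro exI[of _ "{\<one>}"]) simp
  then show "maximal_ideals R \<subseteq> topspace (structure_space R)"
    by (rule openin_subset)
qed

lemma closedin_structure_space:
  assumes "cring R"
  shows "closedin (structure_space R) C \<longleftrightarrow>
    (\<exists>A\<subseteq>carrier R. C = maximal_ideals R \<inter> (\<Inter>a\<in>A. {M \<in> maximal_ideals R. a \<in> M}))"
proof -
  have eq: "C \<subseteq> m \<and> m - C = (\<Union>a\<in>A. m - {M \<in> m. a \<in> M}) \<longleftrightarrow>
      C = m \<inter> (\<Inter>a\<in>A. {M \<in> m. a \<in> M})" for m :: "'a set set" and A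
  proof -
    define K where "K = m \<inter> (\<Inter>a\<in>A. {M \<in> m. a \<in> M})"
    have "(\<Union>a\<in>A. m - {M \<in> m. a \<in> M}) = m - K" "K \<subseteq> m"
      by (auto simp: K_def)
    then show ?thesis
      unfolding K_def[symmetric] by (metis Diff_subset double_diff subset_refl)
  qed
  have ex_conj: "(P \<and> (\<exists>A. Q A \<and> S A)) = (\<exists>A. Q A \<and> P \<and> S A)"
    for P and Q S :: "'a set \<Rightarrow> bool" by blast
  have "closedin (structure_space R) C \<longleftrightarrow>
    (\<exists>A\<subseteq>carrier R. C \<subseteq> maximal_ideals R \<and>
      maximal_ideals R - C = (\<Union>a\<in>A. maximal_ideals R - {M \<in> maximal_ideals R. a \<in> M}))"
    unfolding closedin_def topspace_structure_space[OF assms] openin_structure_space[OF assms]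
    by (rule ex_conj)
  then show ?thesis unfolding eq .
qed

lemma baire_one_const: "baire_one X (\<lambda>x\<in>topspace X. c)"
  unfolding baire_one_def by (rule exI[of _ "\<lambda>n x. c"]) auto

lemma baire_one_add:
  assumes "baire_one X f" "baire_one X g"
  shows "baire_one X (\<lambda>x\<in>topspace X. f x + g x)"
proof -
  obtain F G where
    "\<forall>n::nat. continuous_map X euclideanreal (F n)" "\<forall>x\<in>topspace X. (\<lambda>n. F n x) \<longlonglongrightarrow> f x"
    "\<forall>n::nat. continuous_map X euclideanreal (G n)" "\<forall>x\<in>topspace X. (\<lambda>n. G n x) \<longlonglongrightarrow> g x"
    using assms unfolding baire_one_def by blast
  then show ?thesis
    unfolding baire_one_def
    by (intro exI[of _ "\<lambda>n x. F n x + G n x"]) (auto intro: continuous_map_add tendsto_add)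
qed

lemma baire_one_mult:
  assumes "baire_one X f" "baire_one X g"
  shows "baire_one X (\<lambda>x\<in>topspace X. f x * g x)"
proof -
  obtain F G where
    "\<forall>n::nat. continuous_map X euclideanreal (F n)" "\<forall>x\<in>topspace X. (\<lambda>n. F n x) \<longlonglongrightarrow> f x"
    "\<forall>n::nat. continuous_map X euclideanreal (G n)" "\<forall>x\<in>topspace X. (\<lambda>n. G n x) \<longlonglongrightarrow> g x"
    using assms unfolding baire_one_def by blast
  then show ?thesis
    unfolding baire_one_def
    by (intro exI[of _ "\<lambda>n x. F n x * G n x"]) (auto intro: continuous_map_real_mult tendsto_mult)
qed

lemma cring_pointwise:
  fixes C :: "('a \<Rightarrow> real) set"
  assumes ext: "C \<subseteq> extensional S"
    and const: "\<And>c. (\<lambda>x\<in>S. c) \<in> C"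
    and add: "\<And>f g. f \<in> C \<Longrightarrow> g \<in> C \<Longrightarrow> (\<lambda>x\<in>S. f x + g x) \<in> C"
    and mult: "\<And>f g. f \<in> C \<Longrightarrow> g \<in> C \<Longrightarrow> (\<lambda>x\<in>S. f x * g x) \<in> C"
  shows "cring \<lparr>carrier = C, mult = (\<lambda>f g. \<lambda>x\<in>S. f x * g x), one = (\<lambda>x\<in>S. 1),
    zero = (\<lambda>x\<in>S. 0), add = (\<lambda>f g. \<lambda>x\<in>S. f x + g x)\<rparr>"
proof -
  define R :: "('a \<Rightarrow> real) ring" where "R = \<lparr>carrier = C, mult = (\<lambda>f g. \<lambda>x\<in>S. f x * g x), one = (\<lambda>x\<in>S. 1),
    zero = (\<lambda>x\<in>S. 0), add = (\<lambda>f g. \<lambda>x\<in>S. f x + g x)\<rparr>"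
  have R: "carrier R = C" "mult R f g = (\<lambda>x\<in>S. f x * g x)" "one R = (\<lambda>x\<in>S. 1)"
    "zero R = (\<lambda>x\<in>S. 0)" "add R f g = (\<lambda>x\<in>S. f x + g x)" for f g
    by (simp_all add: R_def)
  have e: "f x = undefined" if "f \<in> C" "x \<notin> S" for f x
    using ext that by (auto simp: extensional_def)
  have neg: "\<exists>g\<in>C. (\<lambda>x\<in>S. g x + f x) = (\<lambda>x\<in>S. 0)" if "f \<in> C" for f
    by (rule bexI[OF _ mult[OF const[of "-1"] that]]) (simp add: fun_eq_iff restrict_def)
  have "cring R"
  proof (rule cringI)
    show "abelian_group R"
      by (intro abelian_groupI; simp only: R; (rule const add neg; assumption?)?)
        (simp_all add: fun_eq_iff restrict_def e)
    show "comm_monoid R"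
      by (intro comm_monoidI; simp only: R; (rule const mult; assumption?)?)
        (simp_all add: fun_eq_iff restrict_def e)
  qed (simp add: R fun_eq_iff restrict_def distrib_right)
  then show ?thesis unfolding R_def .
qed

lemma cring_baire_one_ring: "cring (baire_one_ring X)"
  unfolding baire_one_ring_def
  by (rule cring_pointwise) (auto intro: baire_one_const baire_one_add baire_one_mult)

lemma cring_bounded_baire_one_ring: "cring (bounded_baire_one_ring X)"
  unfolding bounded_baire_one_ring_def baire_one_ring_def partial_object.simps
proof (rule cring_pointwise)
  fix f g
  assume f: "f \<in> {f \<in> {f \<in> extensional (topspace X). baire_one X f}. bounded (f ` topspace X)}"
    and g: "g \<in> {f \<in> {f \<in> extensional (topspace X). baire_one X f}. bounded (f ` topspace X)}"
  then obtain K L where "\<forall>x\<in>topspace X. \<bar>f x\<bar> \<le> K" "\<forall>x\<in>topspace X. \<bar>g x\<bar> \<le> L"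
    by (auto simp: bounded_iff)
  then have "\<forall>x\<in>topspace X. \<bar>f x * g x\<bar> \<le> \<bar>K\<bar> * \<bar>L\<bar>"
    by (fastforce simp: abs_mult intro: mult_mono)
  then have "bounded ((\<lambda>x. f x * g x) ` topspace X)"
    by (auto simp: bounded_iff)
  moreover have "bounded ((\<lambda>x. f x + g x) ` topspace X)"
    using f g by (auto intro: bounded_plus_comp)
  ultimately show "(\<lambda>x\<in>topspace X. f x + g x) \<in>
      {f \<in> {f \<in> extensional (topspace X). baire_one X f}. bounded (f ` topspace X)}"
    "(\<lambda>x\<in>topspace X. f x * g x) \<in>
      {f \<in> {f \<in> extensional (topspace X). baire_one X f}. bounded (f ` topspace X)}"
    using f g by (auto intro: baire_one_add baire_one_mult)
qed (auto simp: bounded_iff intro: baire_one_const)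

end

theory Submission
  imports Defs
begin

text \<open>Write \<open>R\<close> for the ring of all Baire one functions on \<open>X\<close> and \<open>S\<close> for the subring of
  bounded ones. The homeomorphism sends a maximal ideal \<open>M\<close> of \<open>R\<close> to
  \<open>\<mu>(M) = {f \<in> S. (\<bar>f\<bar> - \<epsilon>)\<^sup>+ \<in> M for all \<epsilon> > 0}\<close>, the bounded functions whose residue in \<open>R/M\<close> is
  infinitesimal. (It is the only maximal ideal of \<open>S\<close> above \<open>M \<inter> S\<close>.)

  Everything rests on how the two rings detect units. Replacing the approximants \<open>F n\<close> of a
  positive Baire one function by \<open>max (F n) (1/(n+1))\<close> shows that its reciprocal is Baire one, so a
  sum of two squares without common zero is a unit of \<open>R\<close>. Therefore two members of a maximal
  ideal \<open>M\<close> of \<open>R\<close> have a common zero (\<open>maximalideal_common_zero\<close>), and membership in \<open>M\<close> depends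
  on the zero set only (\<open>maximalideal_zero_set\<close>). In \<open>S\<close>, the units are the functions bounded away from
  \<open>0\<close>, and the role of the zero set of \<open>f\<close> is taken by the sets \<open>{\<bar>f\<bar> \<le> \<epsilon>}\<close>, which are the zero
  sets of \<open>(\<bar>f\<bar> - \<epsilon>)\<^sup>+\<close>. This makes \<open>\<mu>(M)\<close> maximal (\<open>maximalideal_infinitesimal_part\<close>) and lets
  every maximal ideal of \<open>S\<close> be recovered from an ideal of \<open>R\<close> (\<open>infinitesimal_part_surj\<close>).

  Continuity of \<open>\<mu>\<close> is immediate from its definition: \<open>f \<in> \<mu>(M)\<close> is a conjunction of memberships
  in \<open>M\<close>. Injectivity and openness both follow from \<open>infinitesimal_part_separation\<close>: for \<open>a \<notin> M\<close>
  choose \<open>m \<in> M\<close> without a common zero with \<open>a\<close>; the bounded function \<open>a\<^sup>2/(a\<^sup>2 + m\<^sup>2)\<close> is in \<open>\<mu>(N)\<close>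
  whenever \<open>a \<in> N\<close>, yet is \<open>1\<close> on the zero set of \<open>m\<close>, hence not in \<open>\<mu>(M)\<close>.\<close>

section \<open>Maximal ideals of commutative rings\<close>

text \<open>Closure under negation comes for free from multiplication by \<open>\<ominus> \<one>\<close>, so ideals of functions
  can be recognised from sums and products alone.\<close>

lemma (in cring) idealI_closed:
  assumes "I \<subseteq> carrier R" "\<zero> \<in> I"
    and add: "\<And>a b. a \<in> I \<Longrightarrow> b \<in> I \<Longrightarrow> a \<oplus> b \<in> I"
    and mult: "\<And>a r. a \<in> I \<Longrightarrow> r \<in> carrier R \<Longrightarrow> r \<otimes> a \<in> I"
  shows "ideal I R"
proof (rule idealI[OF ring_axioms])
  have "\<ominus> a \<in> I" if "a \<in> I" for a
  proof -
    have "\<ominus> a = \<ominus> \<one> \<otimes> a"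
      using that assms(1) by (simp add: l_minus subset_iff)
    then show ?thesis using mult[OF that, of "\<ominus> \<one>"] by simp
  qed
  then show "subgroup I (add_monoid R)"
    using assms by (intro add.subgroupI) (auto simp: a_inv_def)
  show "a \<otimes> x \<in> I" if "a \<in> I" "x \<in> carrier R" for a x
    using mult[OF that] m_comm[of a x] that assms(1) by auto
qed (use mult in auto)

lemma maximalideal_one_notin:
  fixes R (structure)
  assumes "maximalideal M R"
  shows "\<one> \<notin> M"
proof -
  interpret maximalideal M R by fact
  show ?thesis using I_notcarr one_imp_carrier by blast
qed

lemma maximalideal_subset_carrier:
  assumes "maximalideal M R"
  shows "M \<subseteq> carrier R"
  using additive_subgroup.a_subset ideal.axioms(1) maximalideal.axioms(1)[OF assms] by blast

lemma maximalideal_subset_imp_eq: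
  assumes "maximalideal M R" "maximalideal N R" "M \<subseteq> N"
  shows "M = N"
  using maximalideal.I_maximal[OF assms(1) maximalideal.axioms(1)[OF assms(2)] assms(3)]
    maximalideal_subset_carrier[OF assms(2)] maximalideal.I_notcarr[OF assms(2)] by blast

text \<open>The ideal generated by \<open>M\<close> and an element outside \<open>M\<close> is the whole ring. Together with the
  converse below this replaces reasoning about ideals by a single equation between elements.\<close>

lemma (in cring) maximalideal_comaximal:
  assumes M: "maximalideal M R" and a: "a \<in> carrier R" "a \<notin> M"
  obtains k m where "k \<in> carrier R" "m \<in> M" "k \<otimes> a \<oplus> m = \<one>"
proof -
  interpret M: maximalideal M R by fact
  let ?J = "set_add R (PIdl a) M"
  have id: "ideal ?J R"
    by (rule add_ideals[OF cgenideal_ideal[OF a(1)] M.ideal_axioms])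
  have mem: "x \<in> ?J \<longleftrightarrow> (\<exists>k\<in>carrier R. \<exists>m\<in>M. x = k \<otimes> a \<oplus> m)" for x
    unfolding set_add_defs cgenideal_def by auto
  have "m \<in> ?J" if m: "m \<in> M" for m
  proof -
    have "m \<in> carrier R" using m M.a_subset by blast
    then have "m = \<zero> \<otimes> a \<oplus> m" using a(1) by simp
    then show ?thesis using m mem zero_closed by blast
  qed
  then have sub: "M \<subseteq> ?J" by (rule subsetI)
  have "a \<in> ?J"
  proof -
    have "a = \<one> \<otimes> a \<oplus> \<zero>" using a(1) by simp
    moreover have "\<zero> \<in> M"
      using additive_subgroup.zero_closed[OF M.is_additive_subgroup] .
    ultimately show ?thesis using mem one_closed by blast
  qed
  then have "?J \<noteq> M" using a(2) by blast
  moreover have "?J \<subseteq> carrier R"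
    by (rule additive_subgroup.a_subset[OF ideal.axioms(1)[OF id]])
  ultimately have "?J = carrier R"
    using M.I_maximal[OF id sub] by blast
  then have "\<one> \<in> ?J" by simp
  then obtain k m where "k \<in> carrier R" "m \<in> M" "\<one> = k \<otimes> a \<oplus> m"
    unfolding mem by (elim bexE)
  then show thesis using that by metis
qed

lemma (in cring) maximalidealI_comaximal:
  assumes "ideal I R" "\<one> \<notin> I"
    and co: "\<And>a. a \<in> carrier R \<Longrightarrow> a \<notin> I \<Longrightarrow> \<exists>k\<in>carrier R. \<exists>m\<in>I. k \<otimes> a \<oplus> m = \<one>"
  shows "maximalideal I R"
proof (rule maximalidealI[OF assms(1)])
  show "carrier R \<noteq> I" using assms(2) by auto
next
  fix J assume J: "ideal J R" "I \<subseteq> J" "J \<subseteq> carrier R"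
  interpret J: ideal J R by fact
  show "J = I \<or> J = carrier R"
  proof (cases "J \<subseteq> I")
    case False
    then obtain a where a: "a \<in> J" "a \<notin> I" by blast
    then obtain k m where "k \<in> carrier R" "m \<in> I" "k \<otimes> a \<oplus> m = \<one>"
      using co J(3) by blast
    then have "\<one> \<in> J"
      using J.a_closed[OF J.I_l_closed[OF a(1)], of k m] J(2) by auto
    then show ?thesis using J.one_imp_carrier by blast
  qed (use J(2) in blast)
qed

text \<open>Krull's theorem: by Zorn's lemma, since the union of a chain of ideals avoiding \<open>\<one>\<close> is again
  such an ideal.\<close>

lemma (in cring) proper_ideal_in_maximalideal:
  assumes I: "ideal I R" "\<one> \<notin> I"
  obtains M where "maximalideal M R" "I \<subseteq> M"
proof -
  let ?A = "{J. ideal J R \<and> I \<subseteq> J \<and> \<one> \<notin> J}"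
  have "\<exists>M\<in>?A. \<forall>J\<in>?A. M \<subseteq> J \<longrightarrow> J = M"
  proof (rule subset_Zorn_nonempty)
    show "?A \<noteq> {}" using I by blast
  next
    fix \<C> assume \<C>: "\<C> \<noteq> {}" "subset.chain ?A \<C>"
    have sub: "\<C> \<subseteq> ?A" and chain: "\<And>J K. J \<in> \<C> \<Longrightarrow> K \<in> \<C> \<Longrightarrow> J \<subseteq> K \<or> K \<subseteq> J"
      using \<C>(2) by (auto simp: subset_chain_def)
    have id: "ideal J R" if "J \<in> \<C>" for J using that sub by blast
    have "ideal (\<Union>\<C>) R"
    proof (rule idealI_closed)
      show "\<Union>\<C> \<subseteq> carrier R"
        using id additive_subgroup.a_subset ideal.axioms(1) by blast
      show "\<zero> \<in> \<Union>\<C>"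
        using id additive_subgroup.zero_closed ideal.axioms(1) \<C>(1) by blast
    next
      fix a b assume "a \<in> \<Union>\<C>" "b \<in> \<Union>\<C>"
      then obtain J where "J \<in> \<C>" "a \<in> J" "b \<in> J" using chain by blast
      then show "a \<oplus> b \<in> \<Union>\<C>"
        using additive_subgroup.a_closed[OF ideal.axioms(1)[OF id]] by (metis UnionI)
    next
      fix a r assume "a \<in> \<Union>\<C>" "r \<in> carrier R"
      then show "r \<otimes> a \<in> \<Union>\<C>"
        using ideal.I_l_closed[OF id] by (metis UnionE UnionI)
    qed
    then show "\<Union>\<C> \<in> ?A" using sub \<C>(1) by blast
  qed
  then obtain M where "M \<in> ?A" and max: "\<forall>J\<in>?A. M \<subseteq> J \<longrightarrow> J = M" ..
  then have M: "ideal M R" "I \<subseteq> M" "\<one> \<notin> M" by simp_all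
  have "maximalideal M R"
  proof (rule maximalidealI[OF M(1)])
    show "carrier R \<noteq> M" using M(3) by auto
    show "J = M \<or> J = carrier R" if "ideal J R" "M \<subseteq> J" "J \<subseteq> carrier R" for J
    proof (cases "\<one> \<in> J")
      case True
      then show ?thesis using ideal.one_imp_carrier[OF that(1)] by simp
    next
      case False
      then have "J \<in> ?A" using that M(2) by simp
      then show ?thesis using max that(2) by simp
    qed
  qed
  then show thesis using that M(2) by blast
qed

text \<open>In this form, computing the image or preimage of an open set means relating two inclusions
  \<open>A \<subseteq> M\<close> and \<open>B \<subseteq> N\<close>.\<close>

lemma openin_structure_space_not_subset:
  assumes "cring R"
  shows "openin (structure_space R) U \<longleftrightarrow>
    (\<exists>A\<subseteq>carrier R. U = {M. maximalideal M R \<and> \<not> A \<subseteq> M})"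
proof -
  have "(\<Union>a\<in>A. maximal_ideals R - {M \<in> maximal_ideals R. a \<in> M}) =
      {M. maximalideal M R \<and> \<not> A \<subseteq> M}" for A
    by (auto simp: maximal_ideals_def)
  then show ?thesis by (simp only: openin_structure_space[OF assms])
qed

section \<open>Baire one functions\<close>

lemma baire_one_compose2:
  assumes "baire_one X f" "baire_one X g" and \<phi>: "continuous_on UNIV (\<lambda>p. \<phi> (fst p) (snd p))"
  shows "baire_one X (\<lambda>x\<in>topspace X. \<phi> (f x) (g x))"
proof -
  obtain F G where F: "\<And>n::nat. continuous_map X euclideanreal (F n)"
      "\<And>x. x \<in> topspace X \<Longrightarrow> (\<lambda>n. F n x) \<longlonglongrightarrow> f x"
    and G: "\<And>n::nat. continuous_map X euclideanreal (G n)"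
      "\<And>x. x \<in> topspace X \<Longrightarrow> (\<lambda>n. G n x) \<longlonglongrightarrow> g x"
    using assms unfolding baire_one_def by blast
  have "continuous_map X euclideanreal (\<lambda>x. \<phi> (F n x) (G n x))" for n
  proof -
    have "continuous_map X euclidean (\<lambda>x. (F n x, G n x))"
      using continuous_map_pairedI[OF F(1) G(1)] by simp
    then have "continuous_map X euclideanreal ((\<lambda>p. \<phi> (fst p) (snd p)) \<circ> (\<lambda>x. (F n x, G n x)))"
      by (rule continuous_map_compose) (use \<phi> in simp)
    then show ?thesis by (simp add: o_def)
  qed
  moreover have "(\<lambda>n. \<phi> (F n x) (G n x)) \<longlonglongrightarrow> \<phi> (f x) (g x)" if "x \<in> topspace X" for x
    using continuous_on_tendsto_compose[OF \<phi> tendsto_Pair[OF F(2) G(2)], OF that that] by simp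
  ultimately show ?thesis
    unfolding baire_one_def by (intro exI[of _ "\<lambda>n x. \<phi> (F n x) (G n x)"]) simp
qed

text \<open>The approximants of \<open>f\<close> may vanish or be negative. Cutting them off from below at
  \<open>1/(n+1)\<close> makes them invertible, and the cut-off disappears in the limit because \<open>f\<close> is positive.\<close>

lemma baire_one_inverse:
  assumes "baire_one X f" and pos: "\<And>x. x \<in> topspace X \<Longrightarrow> f x > 0"
  shows "baire_one X (\<lambda>x\<in>topspace X. inverse (f x))"
proof -
  obtain F where F: "\<And>n::nat. continuous_map X euclideanreal (F n)"
      "\<And>x. x \<in> topspace X \<Longrightarrow> (\<lambda>n. F n x) \<longlonglongrightarrow> f x"
    using assms unfolding baire_one_def by blast
  let ?G = "\<lambda>n x. max (F n x) (inverse (real (Suc n)))"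
  have G0: "?G n x > 0" for n x by (simp add: less_max_iff_disj)
  have "continuous_map X euclideanreal (\<lambda>x. inverse (?G n x))" for n
    using G0[of n] by (intro continuous_map_real_inverse continuous_map_real_max F continuous_map_const[THEN iffD2])
      (auto simp: less_imp_neq[THEN not_sym])
  moreover have "(\<lambda>n. inverse (?G n x)) \<longlonglongrightarrow> inverse (f x)" if x: "x \<in> topspace X" for x
  proof -
    have "(\<lambda>n. ?G n x) \<longlonglongrightarrow> max (f x) 0"
      by (intro tendsto_max F(2) x LIMSEQ_inverse_real_of_nat)
    then show ?thesis
      using pos[OF x] by (intro tendsto_inverse) (auto simp: max_def)
  qed
  ultimately show ?thesis
    unfolding baire_one_def by (intro exI[of _ "\<lambda>n x. inverse (?G n x)"]) simp
qed

lemma baire_one_ring_simps: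
  "carrier (baire_one_ring X) = {f \<in> extensional (topspace X). baire_one X f}"
  "f \<otimes>\<^bsub>baire_one_ring X\<^esub> g = (\<lambda>x\<in>topspace X. f x * g x)"
  "f \<oplus>\<^bsub>baire_one_ring X\<^esub> g = (\<lambda>x\<in>topspace X. f x + g x)"
  "\<one>\<^bsub>baire_one_ring X\<^esub> = (\<lambda>x\<in>topspace X. 1)"
  "\<zero>\<^bsub>baire_one_ring X\<^esub> = (\<lambda>x\<in>topspace X. 0)"
  by (simp_all add: baire_one_ring_def)

lemma bounded_baire_one_ring_simps:
  "carrier (bounded_baire_one_ring X) =
    {f \<in> carrier (baire_one_ring X). \<exists>K. \<forall>x\<in>topspace X. \<bar>f x\<bar> \<le> K}"
  "f \<otimes>\<^bsub>bounded_baire_one_ring X\<^esub> g = (\<lambda>x\<in>topspace X. f x * g x)"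
  "f \<oplus>\<^bsub>bounded_baire_one_ring X\<^esub> g = (\<lambda>x\<in>topspace X. f x + g x)"
  "\<one>\<^bsub>bounded_baire_one_ring X\<^esub> = (\<lambda>x\<in>topspace X. 1)"
  "\<zero>\<^bsub>bounded_baire_one_ring X\<^esub> = (\<lambda>x\<in>topspace X. 0)"
  by (auto simp: bounded_baire_one_ring_def baire_one_ring_def bounded_iff)

lemma bounded_carrier_subset:
  "f \<in> carrier (bounded_baire_one_ring X) \<Longrightarrow> f \<in> carrier (baire_one_ring X)"
  by (simp add: bounded_baire_one_ring_simps)

lemma carrier_compose2:
  assumes "f \<in> carrier (baire_one_ring X)" "g \<in> carrier (baire_one_ring X)"
    and "continuous_on UNIV (\<lambda>p. \<phi> (fst p) (snd p))"
  shows "(\<lambda>x\<in>topspace X. \<phi> (f x) (g x)) \<in> carrier (baire_one_ring X)"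
  using baire_one_compose2[OF _ _ assms(3), of X f g] assms(1,2)
  by (simp add: baire_one_ring_simps(1))

lemma carrier_compose:
  assumes "f \<in> carrier (baire_one_ring X)" and "continuous_on UNIV \<phi>"
  shows "(\<lambda>x\<in>topspace X. \<phi> (f x)) \<in> carrier (baire_one_ring X)"
proof (rule carrier_compose2[OF assms(1,1), of "\<lambda>u v. \<phi> u"])
  show "continuous_on UNIV (\<lambda>p::real \<times> real. \<phi> (fst p))"
    by (rule continuous_on_compose2[OF assms(2) continuous_on_fst[OF continuous_on_id]]) simp
qed

lemma carrier_divide:
  assumes "f \<in> carrier (baire_one_ring X)" "g \<in> carrier (baire_one_ring X)"
    and "\<And>x. x \<in> topspace X \<Longrightarrow> g x > 0"
  shows "(\<lambda>x\<in>topspace X. f x / g x) \<in> carrier (baire_one_ring X)"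
proof -
  have "baire_one X f" "baire_one X g"
    using assms(1,2) by (simp_all add: baire_one_ring_simps(1))
  then have "baire_one X (\<lambda>x\<in>topspace X. f x * (\<lambda>x\<in>topspace X. inverse (g x)) x)"
    by (intro baire_one_mult baire_one_inverse assms(3))
  moreover have "(\<lambda>x\<in>topspace X. f x * (\<lambda>x\<in>topspace X. inverse (g x)) x) =
      (\<lambda>x\<in>topspace X. f x / g x)"
    by (rule restrict_ext) (simp add: divide_inverse)
  ultimately show ?thesis by (simp add: baire_one_ring_simps(1))
qed

lemma bounded_carrier_compose:
  assumes "f \<in> carrier (baire_one_ring X)" and "continuous_on UNIV \<phi>"
    and "\<And>x. x \<in> topspace X \<Longrightarrow> \<bar>\<phi> (f x)\<bar> \<le> K"
  shows "(\<lambda>x\<in>topspace X. \<phi> (f x)) \<in> carrier (bounded_baire_one_ring X)"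
  unfolding bounded_baire_one_ring_simps(1) mem_Collect_eq
proof (intro conjI exI ballI)
  show "(\<lambda>x\<in>topspace X. \<phi> (f x)) \<in> carrier (baire_one_ring X)"
    by (rule carrier_compose[OF assms(1,2)])
  show "\<bar>(\<lambda>x\<in>topspace X. \<phi> (f x)) x\<bar> \<le> K" if "x \<in> topspace X" for x
    using assms(3)[OF that] that by simp
qed

text \<open>A bounded Baire one function that inverts \<open>f\<close> wherever \<open>\<bar>f\<bar> \<ge> \<epsilon>\<close>: the reciprocal is
  replaced by the continuous function \<open>t / max t\<^sup>2 \<epsilon>\<^sup>2\<close> of \<open>t = f x\<close>, whose absolute value is at most
  \<open>1/\<epsilon>\<close>.\<close>

definition truncated_inverse :: "'a topology \<Rightarrow> real \<Rightarrow> ('a \<Rightarrow> real) \<Rightarrow> 'a \<Rightarrow> real" where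
  "truncated_inverse X \<epsilon> f = (\<lambda>x\<in>topspace X. f x / max ((f x)\<^sup>2) (\<epsilon>\<^sup>2))"

lemma truncated_inverse_carrier:
  assumes f: "f \<in> carrier (baire_one_ring X)" and \<epsilon>: "\<epsilon> > 0"
  shows "truncated_inverse X \<epsilon> f \<in> carrier (bounded_baire_one_ring X)"
  unfolding truncated_inverse_def
proof (rule bounded_carrier_compose[OF f, where \<phi> = "\<lambda>t. t / max (t\<^sup>2) (\<epsilon>\<^sup>2)" and K = "1 / \<epsilon>"])
  have d: "max (t\<^sup>2) (\<epsilon>\<^sup>2) > 0" for t :: real
    using \<epsilon> by (simp add: less_max_iff_disj)
  show "continuous_on UNIV (\<lambda>t. t / max (t\<^sup>2) (\<epsilon>\<^sup>2))"
    using d by (intro continuous_intros) (simp add: less_imp_neq[THEN not_sym])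
  fix x
  have "\<bar>f x\<bar> * \<epsilon> \<le> max ((f x)\<^sup>2) (\<epsilon>\<^sup>2)"
  proof (cases "\<bar>f x\<bar> \<le> \<epsilon>")
    case True
    then have "\<bar>f x\<bar> * \<epsilon> \<le> \<epsilon>\<^sup>2" using \<epsilon> by (simp add: power2_eq_square mult_right_mono)
    then show ?thesis by simp
  next
    case False
    then have "\<bar>f x\<bar> * \<epsilon> \<le> \<bar>f x\<bar> * \<bar>f x\<bar>" by (intro mult_left_mono) auto
    then show ?thesis by (simp add: power2_eq_square)
  qed
  then show "\<bar>f x / max ((f x)\<^sup>2) (\<epsilon>\<^sup>2)\<bar> \<le> 1 / \<epsilon>"
    using d[of "f x"] \<epsilon> by (simp add: abs_divide field_simps)
qed

lemma truncated_inverse_mult: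
  assumes "x \<in> topspace X" "\<epsilon> > 0" "\<bar>f x\<bar> \<ge> \<epsilon>"
  shows "truncated_inverse X \<epsilon> f x * f x = 1"
proof -
  have "\<epsilon>\<^sup>2 \<le> (f x)\<^sup>2" "f x \<noteq> 0"
    using assms by (auto simp: abs_le_square_iff[symmetric])
  then show ?thesis
    using assms(1) by (simp add: truncated_inverse_def max_absorb1 power2_eq_square)
qed

section \<open>Ideals and zero sets\<close>

text \<open>The zero set of \<open>f\<^sup>2 + g\<^sup>2\<close> is the intersection of the two zero sets.\<close>

lemma maximalideal_square_sum:
  assumes "maximalideal M (baire_one_ring X)" "f \<in> M" "g \<in> M"
  shows "(\<lambda>x\<in>topspace X. (f x)\<^sup>2 + (g x)\<^sup>2) \<in> M"
proof -
  interpret M: maximalideal M "baire_one_ring X" by fact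
  have "f \<otimes>\<^bsub>baire_one_ring X\<^esub> f \<oplus>\<^bsub>baire_one_ring X\<^esub> g \<otimes>\<^bsub>baire_one_ring X\<^esub> g \<in> M"
    using assms(2,3) M.a_subset by (blast intro: M.a_closed M.I_l_closed)
  then show ?thesis
    by (simp add: baire_one_ring_simps power2_eq_square restrict_def cong: if_cong)
qed

text \<open>Otherwise \<open>f\<^sup>2 + g\<^sup>2\<close> would be positive, hence a unit in \<open>M\<close>.\<close>

lemma maximalideal_common_zero:
  assumes M: "maximalideal M (baire_one_ring X)" and fg: "f \<in> M" "g \<in> M"
  obtains x where "x \<in> topspace X" "f x = 0" "g x = 0"
proof (rule ccontr)
  interpret M: maximalideal M "baire_one_ring X" by fact
  assume "\<not> thesis"
  then have pos: "(f x)\<^sup>2 + (g x)\<^sup>2 > 0" if "x \<in> topspace X" for x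
    using that \<open>\<And>x. x \<in> topspace X \<Longrightarrow> f x = 0 \<Longrightarrow> g x = 0 \<Longrightarrow> thesis\<close>
    by (metis sum_power2_gt_zero_iff)
  let ?s = "\<lambda>x\<in>topspace X. (f x)\<^sup>2 + (g x)\<^sup>2"
  have s: "?s \<in> M" by (rule maximalideal_square_sum[OF M fg])
  have "(\<lambda>x\<in>topspace X. 1 / ?s x) \<in> carrier (baire_one_ring X)"
    using carrier_divide[OF M.one_closed, of ?s] s M.a_subset pos
    by (auto simp: baire_one_ring_simps(4) restrict_def cong: if_cong)
  from M.I_l_closed[OF s this]
  have "(\<lambda>x\<in>topspace X. 1 / ?s x * ?s x) \<in> M"
    by (simp add: baire_one_ring_simps restrict_def cong: if_cong)
  also have "(\<lambda>x\<in>topspace X. 1 / ?s x * ?s x) = \<one>\<^bsub>baire_one_ring X\<^esub>"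
    unfolding baire_one_ring_simps(4) using pos by (intro restrict_ext) fastforce
  finally show False using maximalideal_one_notin[OF M] by blast
qed

text \<open>If \<open>g\<close> were outside \<open>M\<close>, then \<open>k g + m = 1\<close> for some \<open>m \<in> M\<close>; at a common zero of \<open>f\<close> and \<open>m\<close>
  the left side vanishes.\<close>

lemma maximalideal_zero_set:
  assumes M: "maximalideal M (baire_one_ring X)" and f: "f \<in> M"
    and g: "g \<in> carrier (baire_one_ring X)"
    and fg: "\<And>x. x \<in> topspace X \<Longrightarrow> f x = 0 \<Longrightarrow> g x = 0"
  shows "g \<in> M"
proof (rule ccontr)
  assume "g \<notin> M"
  then obtain k m where "m \<in> M"
    and eq: "k \<otimes>\<^bsub>baire_one_ring X\<^esub> g \<oplus>\<^bsub>baire_one_ring X\<^esub> m = \<one>\<^bsub>baire_one_ring X\<^esub>"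
    using cring.maximalideal_comaximal[OF cring_baire_one_ring M g] by metis
  then obtain x where "x \<in> topspace X" "f x = 0" "m x = 0"
    using maximalideal_common_zero[OF M f] by blast
  then show False
    using fg fun_cong[OF eq, of x] by (simp add: baire_one_ring_simps)
qed

text \<open>The function \<open>(\<bar>f\<bar> - \<epsilon>)\<^sup>+\<close>; it turns the set where \<open>\<bar>f\<bar> \<le> \<epsilon>\<close> into a zero set.\<close>

definition excess :: "'a topology \<Rightarrow> real \<Rightarrow> ('a \<Rightarrow> real) \<Rightarrow> 'a \<Rightarrow> real" where
  "excess X \<epsilon> f = (\<lambda>x\<in>topspace X. max 0 (\<bar>f x\<bar> - \<epsilon>))"

lemma excess_carrier:
  "f \<in> carrier (baire_one_ring X) \<Longrightarrow> excess X \<epsilon> f \<in> carrier (baire_one_ring X)"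
  unfolding excess_def by (rule carrier_compose[where \<phi> = "\<lambda>t. max 0 (\<bar>t\<bar> - \<epsilon>)"])
    (assumption, intro continuous_on_max continuous_on_const continuous_on_diff
      continuous_on_rabs continuous_on_id)

lemma excess_eq_0_iff: "x \<in> topspace X \<Longrightarrow> excess X \<epsilon> f x = 0 \<longleftrightarrow> \<bar>f x\<bar> \<le> \<epsilon>"
  by (auto simp: excess_def max_def)

section \<open>From maximal ideals of all functions to those of bounded functions\<close>

text \<open>In the ordered field \<open>R/M\<close>, \<open>(\<bar>f\<bar> - \<epsilon>)\<^sup>+ \<in> M\<close> means \<open>\<bar>f\<bar> \<le> \<epsilon>\<close>, so this is the set of bounded
  functions with infinitesimal residue.\<close>

definition infinitesimal_part :: "'a topology \<Rightarrow> ('a \<Rightarrow> real) set \<Rightarrow> ('a \<Rightarrow> real) set" where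
  "infinitesimal_part X M =
    {f \<in> carrier (bounded_baire_one_ring X). \<forall>\<epsilon>>0. excess X \<epsilon> f \<in> M}"

lemma bounded_mem_infinitesimal_part:
  assumes M: "maximalideal M (baire_one_ring X)"
    and f: "f \<in> M" "f \<in> carrier (bounded_baire_one_ring X)"
  shows "f \<in> infinitesimal_part X M"
proof -
  have "excess X \<epsilon> f \<in> M" if "\<epsilon> > 0" for \<epsilon>
  proof (rule maximalideal_zero_set[OF M f(1)])
    show "excess X \<epsilon> f \<in> carrier (baire_one_ring X)"
      by (rule excess_carrier[OF bounded_carrier_subset[OF f(2)]])
    show "excess X \<epsilon> f x = 0" if "x \<in> topspace X" "f x = 0" for x
      using that \<open>\<epsilon> > 0\<close> by (simp add: excess_eq_0_iff)
  qed
  then show ?thesis using f(2) by (simp add: infinitesimal_part_def)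
qed

text \<open>The triangle inequality, read on zero sets: \<open>\<bar>f + g\<bar> \<le> \<epsilon>\<close> where \<open>\<bar>f\<bar>\<close> and \<open>\<bar>g\<bar>\<close> are at most
  \<open>\<epsilon>/2\<close>, and \<open>\<bar>r f\<bar> \<le> \<epsilon>\<close> where \<open>\<bar>f\<bar> \<le> \<epsilon>/L\<close> for a bound \<open>L\<close> of \<open>\<bar>r\<bar>\<close>.\<close>

lemma ideal_infinitesimal_part:
  assumes M: "maximalideal M (baire_one_ring X)"
  shows "ideal (infinitesimal_part X M) (bounded_baire_one_ring X)"
proof -
  let ?S = "bounded_baire_one_ring X"
  interpret S: cring ?S by (rule cring_bounded_baire_one_ring)
  interpret M: maximalideal M "baire_one_ring X" by fact
  show ?thesis
  proof (rule S.idealI_closed)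
    show "infinitesimal_part X M \<subseteq> carrier ?S"
      by (auto simp: infinitesimal_part_def)
    have "\<zero>\<^bsub>?S\<^esub> \<in> M"
      using additive_subgroup.zero_closed[OF M.is_additive_subgroup]
      unfolding baire_one_ring_simps bounded_baire_one_ring_simps .
    then show "\<zero>\<^bsub>?S\<^esub> \<in> infinitesimal_part X M"
      by (intro bounded_mem_infinitesimal_part[OF M]) auto
  next
    fix f g assume fg: "f \<in> infinitesimal_part X M" "g \<in> infinitesimal_part X M"
    then have carr: "f \<oplus>\<^bsub>?S\<^esub> g \<in> carrier ?S" by (simp add: infinitesimal_part_def)
    have "excess X \<epsilon> (f \<oplus>\<^bsub>?S\<^esub> g) \<in> M" if "\<epsilon> > 0" for \<epsilon>
    proof (rule maximalideal_zero_set[OF M maximalideal_square_sum[OF M]])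
      show "excess X (\<epsilon>/2) f \<in> M" "excess X (\<epsilon>/2) g \<in> M"
        using fg that by (auto simp: infinitesimal_part_def)
      show "excess X \<epsilon> (f \<oplus>\<^bsub>?S\<^esub> g) \<in> carrier (baire_one_ring X)"
        by (intro excess_carrier bounded_carrier_subset carr)
    next
      fix x assume "x \<in> topspace X"
        "(\<lambda>x\<in>topspace X. (excess X (\<epsilon>/2) f x)\<^sup>2 + (excess X (\<epsilon>/2) g x)\<^sup>2) x = 0"
      then have x: "x \<in> topspace X" "\<bar>f x\<bar> \<le> \<epsilon>/2" "\<bar>g x\<bar> \<le> \<epsilon>/2"
        by (auto simp: sum_power2_eq_zero_iff excess_eq_0_iff)
      then show "excess X \<epsilon> (f \<oplus>\<^bsub>?S\<^esub> g) x = 0"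
        by (simp add: excess_eq_0_iff bounded_baire_one_ring_simps)
    qed
    then show "f \<oplus>\<^bsub>?S\<^esub> g \<in> infinitesimal_part X M"
      using carr by (simp add: infinitesimal_part_def)
  next
    fix f r assume f: "f \<in> infinitesimal_part X M" and r: "r \<in> carrier ?S"
    then have carr: "r \<otimes>\<^bsub>?S\<^esub> f \<in> carrier ?S" by (simp add: infinitesimal_part_def)
    obtain K where K: "\<And>x. x \<in> topspace X \<Longrightarrow> \<bar>r x\<bar> \<le> K"
      using r by (auto simp: bounded_baire_one_ring_simps)
    \<comment> \<open>The quotient \<open>\<epsilon>/L\<close> requires a positive bound, and \<open>K\<close> may be \<open>0\<close> when \<open>r = 0\<close>.\<close>
    define L where "L = max K 1"
    have L: "L > 0" "\<And>x. x \<in> topspace X \<Longrightarrow> \<bar>r x\<bar> \<le> L"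
      using K by (force simp: L_def)+
    have "excess X \<epsilon> (r \<otimes>\<^bsub>?S\<^esub> f) \<in> M" if "\<epsilon> > 0" for \<epsilon>
    proof (rule maximalideal_zero_set[OF M])
      show "excess X (\<epsilon>/L) f \<in> M"
        using f that L(1) by (auto simp: infinitesimal_part_def)
      show "excess X \<epsilon> (r \<otimes>\<^bsub>?S\<^esub> f) \<in> carrier (baire_one_ring X)"
        by (intro excess_carrier bounded_carrier_subset carr)
    next
      fix x assume x: "x \<in> topspace X" "excess X (\<epsilon>/L) f x = 0"
      then have "\<bar>r x\<bar> * \<bar>f x\<bar> \<le> L * (\<epsilon>/L)"
        using L by (intro mult_mono) (auto simp: excess_eq_0_iff)
      then show "excess X \<epsilon> (r \<otimes>\<^bsub>?S\<^esub> f) x = 0"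
        using x L(1) by (simp add: excess_eq_0_iff bounded_baire_one_ring_simps abs_mult)
    qed
    then show "r \<otimes>\<^bsub>?S\<^esub> f \<in> infinitesimal_part X M"
      using carr by (simp add: infinitesimal_part_def)
  qed
qed

text \<open>If \<open>f \<notin> \<mu>(M)\<close>, some \<open>(\<bar>f\<bar> - \<epsilon>)\<^sup>+\<close> is invertible modulo \<open>M\<close>, so some \<open>m \<in> M\<close> has all its zeros in
  \<open>{\<bar>f\<bar> > \<epsilon>}\<close>. There the truncated inverse \<open>k\<close> is a true inverse of \<open>f\<close>, so \<open>1 - k f\<close> vanishes
  wherever \<open>m\<close> does and lies in \<open>M\<close>. Being bounded, it lies in \<open>\<mu>(M)\<close>, and \<open>f\<close> is invertible modulo
  \<open>\<mu>(M)\<close>.\<close>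

lemma maximalideal_infinitesimal_part:
  assumes M: "maximalideal M (baire_one_ring X)"
  shows "maximalideal (infinitesimal_part X M) (bounded_baire_one_ring X)"
proof -
  let ?R = "baire_one_ring X" and ?S = "bounded_baire_one_ring X"
  interpret S: cring ?S by (rule cring_bounded_baire_one_ring)
  show ?thesis
  proof (rule S.maximalidealI_comaximal[OF ideal_infinitesimal_part[OF M]])
    show "\<one>\<^bsub>?S\<^esub> \<notin> infinitesimal_part X M"
    proof
      assume "\<one>\<^bsub>?S\<^esub> \<in> infinitesimal_part X M"
      then have "excess X (1/2) \<one>\<^bsub>?S\<^esub> \<in> M" by (simp add: infinitesimal_part_def)
      then obtain x where "x \<in> topspace X" "excess X (1/2) \<one>\<^bsub>?S\<^esub> x = 0"
        using maximalideal_common_zero[OF M] by metis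
      then show False by (simp add: excess_eq_0_iff bounded_baire_one_ring_simps)
    qed
  next
    fix f assume f: "f \<in> carrier ?S" "f \<notin> infinitesimal_part X M"
    then obtain \<epsilon> where \<epsilon>: "\<epsilon> > 0" "excess X \<epsilon> f \<notin> M"
      by (auto simp: infinitesimal_part_def)
    have fR: "f \<in> carrier ?R" by (rule bounded_carrier_subset[OF f(1)])
    obtain j m where m: "m \<in> M" and eq: "j \<otimes>\<^bsub>?R\<^esub> excess X \<epsilon> f \<oplus>\<^bsub>?R\<^esub> m = \<one>\<^bsub>?R\<^esub>"
      using cring.maximalideal_comaximal[OF cring_baire_one_ring M excess_carrier[OF fR] \<epsilon>(2)]
      by metis
    have big: "\<bar>f x\<bar> > \<epsilon>" if "x \<in> topspace X" "m x = 0" for x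
      using fun_cong[OF eq, of x] that excess_eq_0_iff[of x X \<epsilon> f]
      by (fastforce simp: baire_one_ring_simps)
    define k where "k = truncated_inverse X \<epsilon> f"
    have k: "k \<in> carrier ?S"
      unfolding k_def by (rule truncated_inverse_carrier[OF fR \<epsilon>(1)])
    \<comment> \<open>This is \<open>1 - k f\<close>, written with sums and products only, the form in which the operations of the ring are given.\<close>
    define h where "h = (\<lambda>x\<in>topspace X. 1 + (\<lambda>x\<in>topspace X. - 1) x * (k \<otimes>\<^bsub>?S\<^esub> f) x)"
    have "(\<lambda>x\<in>topspace X. - 1) \<in> carrier ?S"
      using baire_one_const[of X "-1"]
      by (auto simp: bounded_baire_one_ring_simps baire_one_ring_simps)
    then have "\<one>\<^bsub>?S\<^esub> \<oplus>\<^bsub>?S\<^esub> (\<lambda>x\<in>topspace X. - 1) \<otimes>\<^bsub>?S\<^esub> (k \<otimes>\<^bsub>?S\<^esub> f) \<in> carrier ?S"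
      using k f(1) by simp
    then have h: "h \<in> carrier ?S"
      by (simp add: h_def bounded_baire_one_ring_simps(2-5) restrict_def cong: if_cong)
    have "h \<in> M"
    proof (rule maximalideal_zero_set[OF M m bounded_carrier_subset[OF h]])
      fix x assume x: "x \<in> topspace X" "m x = 0"
      then show "h x = 0"
        using truncated_inverse_mult[OF x(1) \<epsilon>(1), of f] big[OF x]
        by (simp add: h_def k_def bounded_baire_one_ring_simps)
    qed
    then have "h \<in> infinitesimal_part X M"
      by (rule bounded_mem_infinitesimal_part[OF M _ h])
    moreover have "k \<otimes>\<^bsub>?S\<^esub> f \<oplus>\<^bsub>?S\<^esub> h = \<one>\<^bsub>?S\<^esub>"
      by (auto simp: h_def bounded_baire_one_ring_simps)
    ultimately show "\<exists>k\<in>carrier ?S. \<exists>h\<in>infinitesimal_part X M. k \<otimes>\<^bsub>?S\<^esub> f \<oplus>\<^bsub>?S\<^esub> h = \<one>\<^bsub>?S\<^esub>"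
      using k by blast
  qed
qed

text \<open>The functions \<open>h = a\<^sup>2/(a\<^sup>2 + m\<^sup>2)\<close> and \<open>h' = m\<^sup>2/(a\<^sup>2 + m\<^sup>2)\<close> add up to \<open>1\<close>, are
  bounded by \<open>1\<close> and vanish exactly where \<open>a\<close> and \<open>m\<close> do. Since \<open>h' \<in> M\<close>, the function \<open>h\<close> has residue \<open>1\<close> in
  \<open>R/M\<close>, which is not infinitesimal, whereas \<open>h\<close> belongs to every \<open>N\<close> containing \<open>a\<close>. The choice of \<open>h\<close>
  depends on \<open>a\<close> and \<open>M\<close> but not on \<open>N\<close>, which openness of the map requires.\<close>

lemma infinitesimal_part_separation:
  assumes M: "maximalideal M (baire_one_ring X)"
    and a: "a \<in> carrier (baire_one_ring X)" "a \<notin> M"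
  obtains h where "h \<in> carrier (bounded_baire_one_ring X)" "h \<notin> infinitesimal_part X M"
    "\<And>N. maximalideal N (baire_one_ring X) \<Longrightarrow> a \<in> N \<Longrightarrow> h \<in> infinitesimal_part X N"
proof -
  let ?R = "baire_one_ring X" and ?S = "bounded_baire_one_ring X"
  obtain k m where m: "m \<in> M" and eq: "k \<otimes>\<^bsub>?R\<^esub> a \<oplus>\<^bsub>?R\<^esub> m = \<one>\<^bsub>?R\<^esub>"
    using cring.maximalideal_comaximal[OF cring_baire_one_ring M a] by metis
  have mR: "m \<in> carrier ?R" using m maximalideal_subset_carrier[OF M] by blast
  have pos: "(a x)\<^sup>2 + (m x)\<^sup>2 > 0" if "x \<in> topspace X" for x
    using fun_cong[OF eq, of x] that
    by (auto simp: baire_one_ring_simps sum_power2_gt_zero_iff)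
  have cont: "continuous_on UNIV (\<lambda>t::real. t\<^sup>2)"
    "continuous_on UNIV (\<lambda>p::real \<times> real. (fst p)\<^sup>2 + (snd p)\<^sup>2)"
    by (intro continuous_intros)+
  have frac: "(\<lambda>x\<in>topspace X. (b x)\<^sup>2 / ((a x)\<^sup>2 + (m x)\<^sup>2)) \<in> carrier ?R"
    if "b \<in> carrier ?R" for b
    using carrier_divide[OF carrier_compose[OF that, of "\<lambda>t. t\<^sup>2"]
        carrier_compose2[OF a(1) mR, of "\<lambda>s t. s\<^sup>2 + t\<^sup>2"]] pos cont
    by (simp add: restrict_def cong: if_cong)
  define h where "h = (\<lambda>x\<in>topspace X. (a x)\<^sup>2 / ((a x)\<^sup>2 + (m x)\<^sup>2))"
  define h' where "h' = (\<lambda>x\<in>topspace X. (m x)\<^sup>2 / ((a x)\<^sup>2 + (m x)\<^sup>2))"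
  have hR: "h \<in> carrier ?R" "h' \<in> carrier ?R"
    unfolding h_def h'_def by (intro frac a(1) mR)+
  have hS: "h \<in> carrier ?S"
    using hR(1) pos by (auto simp: bounded_baire_one_ring_simps h_def intro!: exI[of _ 1])
  have "h' \<in> M"
    by (rule maximalideal_zero_set[OF M m hR(2)]) (simp add: h'_def)
  have "h \<notin> infinitesimal_part X M"
  proof
    assume "h \<in> infinitesimal_part X M"
    then have "excess X (1/2) h \<in> M" by (simp add: infinitesimal_part_def)
    then obtain x where x: "x \<in> topspace X" "excess X (1/2) h x = 0" "h' x = 0"
      using maximalideal_common_zero[OF M _ \<open>h' \<in> M\<close>] by metis
    then have "m x = 0" using pos[OF x(1)] by (auto simp: h'_def)
    then show False using x pos[OF x(1)] by (simp add: excess_eq_0_iff h_def)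
  qed
  moreover have "h \<in> infinitesimal_part X N" if N: "maximalideal N ?R" "a \<in> N" for N
  proof (rule bounded_mem_infinitesimal_part[OF N(1) _ hS])
    show "h \<in> N" by (rule maximalideal_zero_set[OF N hR(1)]) (simp add: h_def)
  qed
  ultimately show thesis using that hS by blast
qed

text \<open>The functions that vanish on some \<open>{\<bar>f\<bar> \<le> \<epsilon>}\<close> with \<open>f \<in> N\<close> and \<open>\<epsilon> > 0\<close> form an ideal \<open>I\<close> of \<open>R\<close>.
  It is proper, because \<open>{\<bar>f\<bar> \<le> \<epsilon>}\<close> cannot be empty: \<open>f\<close> would be a unit of \<open>S\<close>. Any maximal ideal
  \<open>M\<close> above \<open>I\<close> contains all \<open>(\<bar>f\<bar> - \<epsilon>)\<^sup>+\<close> with \<open>f \<in> N\<close>, so \<open>N \<subseteq> \<mu>(M)\<close>, and equality holds by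
  maximality of \<open>N\<close>.\<close>

lemma infinitesimal_part_surj:
  assumes N: "maximalideal N (bounded_baire_one_ring X)"
  obtains M where "maximalideal M (baire_one_ring X)" "infinitesimal_part X M = N"
proof -
  let ?R = "baire_one_ring X" and ?S = "bounded_baire_one_ring X"
  interpret R: cring ?R by (rule cring_baire_one_ring)
  interpret N: maximalideal N ?S by fact
  define I where "I = {g \<in> carrier ?R. \<exists>f\<in>N. \<exists>\<epsilon>>0. \<forall>x\<in>topspace X. \<bar>f x\<bar> \<le> \<epsilon> \<longrightarrow> g x = 0}"
  have I_intro: "g \<in> I" if "g \<in> carrier ?R" "f \<in> N" "\<epsilon> > 0"
    "\<And>x. x \<in> topspace X \<Longrightarrow> \<bar>f x\<bar> \<le> \<epsilon> \<Longrightarrow> g x = 0" for f g \<epsilon>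
    unfolding I_def using that by blast
  have I_elim: "\<exists>f \<epsilon>. f \<in> N \<and> \<epsilon> > 0 \<and> (\<forall>x\<in>topspace X. \<bar>f x\<bar> \<le> \<epsilon> \<longrightarrow> g x = 0)"
    if "g \<in> I" for g
    using that unfolding I_def by blast
  have NS: "N \<subseteq> carrier ?S" by (rule N.a_subset)
  have "ideal I ?R"
  proof (rule R.idealI_closed)
    show "I \<subseteq> carrier ?R" by (auto simp: I_def)
    show "\<zero>\<^bsub>?R\<^esub> \<in> I"
    proof -
      have "\<zero>\<^bsub>?S\<^esub> \<in> N"
        using additive_subgroup.zero_closed[OF N.is_additive_subgroup] .
      moreover have "\<forall>x\<in>topspace X. \<bar>\<zero>\<^bsub>?S\<^esub> x\<bar> \<le> (1::real) \<longrightarrow> \<zero>\<^bsub>?R\<^esub> x = 0"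
        by (simp add: baire_one_ring_simps)
      ultimately show ?thesis
        unfolding I_def using R.zero_closed zero_less_one by blast
    qed
  next
    fix a b assume "a \<in> I" "b \<in> I"
    then obtain f g \<delta> \<epsilon> where ab: "a \<in> carrier ?R" "b \<in> carrier ?R"
      and fg: "f \<in> N" "g \<in> N" and pos: "\<delta> > 0" "\<epsilon> > 0"
      and a0: "\<And>x. x \<in> topspace X \<Longrightarrow> \<bar>f x\<bar> \<le> \<delta> \<Longrightarrow> a x = 0"
      and b0: "\<And>x. x \<in> topspace X \<Longrightarrow> \<bar>g x\<bar> \<le> \<epsilon> \<Longrightarrow> b x = 0"
      unfolding I_def by blast
    \<comment> \<open>Where \<open>f\<^sup>2 + g\<^sup>2\<close> is at most the square of the smaller bound, both \<open>f\<close> and \<open>g\<close> are within their bounds.\<close>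
    let ?s = "f \<otimes>\<^bsub>?S\<^esub> f \<oplus>\<^bsub>?S\<^esub> g \<otimes>\<^bsub>?S\<^esub> g"
    have "?s \<in> N" using fg NS by (blast intro: N.a_closed N.I_l_closed)
    moreover have "(a \<oplus>\<^bsub>?R\<^esub> b) x = 0" if x: "x \<in> topspace X" "\<bar>?s x\<bar> \<le> (min \<delta> \<epsilon>)\<^sup>2" for x
    proof -
      have le: "(f x)\<^sup>2 + (g x)\<^sup>2 \<le> (min \<delta> \<epsilon>)\<^sup>2"
        using x by (simp add: bounded_baire_one_ring_simps power2_eq_square)
      have "\<bar>f x\<bar>\<^sup>2 \<le> (min \<delta> \<epsilon>)\<^sup>2" "\<bar>g x\<bar>\<^sup>2 \<le> (min \<delta> \<epsilon>)\<^sup>2"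
        using le zero_le_power2[of "f x"] zero_le_power2[of "g x"] unfolding power2_abs
        by linarith+
      moreover have "0 \<le> min \<delta> \<epsilon>" using pos by simp
      ultimately have "\<bar>f x\<bar> \<le> min \<delta> \<epsilon>" "\<bar>g x\<bar> \<le> min \<delta> \<epsilon>"
        using power2_le_imp_le by blast+
      then show ?thesis using a0[OF x(1)] b0[OF x(1)] x(1) by (simp add: baire_one_ring_simps)
    qed
    moreover have "(min \<delta> \<epsilon>)\<^sup>2 > 0" using pos by simp
    ultimately show "a \<oplus>\<^bsub>?R\<^esub> b \<in> I"
      using I_intro[OF R.a_closed[OF ab]] by blast
  next
    fix a r assume a: "a \<in> I" and r: "r \<in> carrier ?R"
    then have carr: "r \<otimes>\<^bsub>?R\<^esub> a \<in> carrier ?R" by (simp add: I_def)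
    obtain f \<epsilon> where f: "f \<in> N" "\<epsilon> > 0"
      and a0: "\<forall>x\<in>topspace X. \<bar>f x\<bar> \<le> \<epsilon> \<longrightarrow> a x = 0"
      using I_elim[OF a] by blast
    show "r \<otimes>\<^bsub>?R\<^esub> a \<in> I"
      by (rule I_intro[OF carr f]) (use a0 in \<open>simp add: baire_one_ring_simps(2)\<close>)
  qed
  moreover have "\<one>\<^bsub>?R\<^esub> \<notin> I"
  proof
    assume "\<one>\<^bsub>?R\<^esub> \<in> I"
    then obtain f \<epsilon> where f: "f \<in> N" and \<epsilon>: "\<epsilon> > 0"
      and zero: "\<forall>x\<in>topspace X. \<bar>f x\<bar> \<le> \<epsilon> \<longrightarrow> \<one>\<^bsub>?R\<^esub> x = 0"
      using I_elim by blast
    have big: "\<bar>f x\<bar> > \<epsilon>" if "x \<in> topspace X" for x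
    proof (rule ccontr)
      assume "\<not> \<bar>f x\<bar> > \<epsilon>"
      then have "\<one>\<^bsub>?R\<^esub> x = 0" using zero that by simp
      then show False using that by (simp add: baire_one_ring_simps(4))
    qed
    have "truncated_inverse X \<epsilon> f \<in> carrier ?S"
      using truncated_inverse_carrier[OF bounded_carrier_subset \<epsilon>] f NS by blast
    from N.I_l_closed[OF f this] have "truncated_inverse X \<epsilon> f \<otimes>\<^bsub>?S\<^esub> f \<in> N" .
    also have "truncated_inverse X \<epsilon> f \<otimes>\<^bsub>?S\<^esub> f = \<one>\<^bsub>?S\<^esub>"
      unfolding bounded_baire_one_ring_simps
      by (intro restrict_ext truncated_inverse_mult[OF _ \<epsilon>] less_imp_le[OF big])
    finally show False using maximalideal_one_notin[OF N] by blast
  qed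
  ultimately obtain M where M: "maximalideal M ?R" "I \<subseteq> M"
    using R.proper_ideal_in_maximalideal by blast
  have "N \<subseteq> infinitesimal_part X M"
  proof
    fix f assume f: "f \<in> N"
    then have fR: "f \<in> carrier ?R" using NS bounded_carrier_subset by blast
    have "excess X \<epsilon> f \<in> I" if "\<epsilon> > 0" for \<epsilon>
      by (rule I_intro[OF excess_carrier[OF fR] f that]) (simp add: excess_eq_0_iff)
    then show "f \<in> infinitesimal_part X M"
      using f NS M(2) by (auto simp: infinitesimal_part_def)
  qed
  then have "N = infinitesimal_part X M"
    by (rule maximalideal_subset_imp_eq[OF N maximalideal_infinitesimal_part[OF M(1)]])
  then show thesis using that M(1) by blast
qed

lemma homeomorphic_map_infinitesimal_part:
  "homeomorphic_map (structure_space (baire_one_ring X))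
    (structure_space (bounded_baire_one_ring X)) (infinitesimal_part X)"
proof (rule bijective_open_imp_homeomorphic_map)
  let ?R = "baire_one_ring X" and ?S = "bounded_baire_one_ring X"
  note openR = openin_structure_space_not_subset[OF cring_baire_one_ring[of X]]
    and openS = openin_structure_space_not_subset[OF cring_bounded_baire_one_ring[of X]]
    and topR = topspace_structure_space[OF cring_baire_one_ring[of X]]
    and topS = topspace_structure_space[OF cring_bounded_baire_one_ring[of X]]
  show surj: "infinitesimal_part X ` topspace (structure_space ?R) = topspace (structure_space ?S)"
    unfolding topR topS maximal_ideals_def
    by (auto intro: maximalideal_infinitesimal_part elim: infinitesimal_part_surj)
  show "inj_on (infinitesimal_part X) (topspace (structure_space ?R))"
  proof (rule inj_onI, unfold topR maximal_ideals_def mem_Collect_eq)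
    fix M N assume MN: "maximalideal M ?R" "maximalideal N ?R"
      and eq: "infinitesimal_part X M = infinitesimal_part X N"
    have "N \<subseteq> M"
    proof
      fix a assume a: "a \<in> N"
      show "a \<in> M"
      proof (rule ccontr)
        assume "a \<notin> M"
        then obtain h where "h \<notin> infinitesimal_part X M" "h \<in> infinitesimal_part X N"
          using infinitesimal_part_separation[OF MN(1)] MN(2) a
            maximalideal_subset_carrier[OF MN(2)] by (metis subsetD)
        then show False using eq by blast
      qed
    qed
    then show "M = N" using maximalideal_subset_imp_eq[OF MN(2,1)] by blast
  qed
  show "continuous_map (structure_space ?R) (structure_space ?S) (infinitesimal_part X)"
    unfolding continuous_map_def
  proof (intro conjI allI impI)
    show "infinitesimal_part X \<in> topspace (structure_space ?R) \<rightarrow> topspace (structure_space ?S)"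
      using surj by blast
    fix U assume "openin (structure_space ?S) U"
    then obtain A where A: "A \<subseteq> carrier ?S" and U: "U = {N. maximalideal N ?S \<and> \<not> A \<subseteq> N}"
      unfolding openS by (elim exE conjE)
    define B where "B = {excess X \<epsilon> a |a \<epsilon>. a \<in> A \<and> \<epsilon> > 0}"
    have "excess X \<epsilon> a \<in> carrier ?R" if "a \<in> A" for a \<epsilon>
      using that A by (intro excess_carrier bounded_carrier_subset) (rule subsetD)
    then have B: "B \<subseteq> carrier ?R" by (auto simp: B_def)
    have "A \<subseteq> infinitesimal_part X M \<longleftrightarrow> B \<subseteq> M" for M
      using A by (auto simp: B_def infinitesimal_part_def)
    then have "{M \<in> topspace (structure_space ?R). infinitesimal_part X M \<in> U} =
        {M. maximalideal M ?R \<and> \<not> B \<subseteq> M}"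
      using maximalideal_infinitesimal_part by (auto simp: topR maximal_ideals_def U)
    then show "openin (structure_space ?R)
        {M \<in> topspace (structure_space ?R). infinitesimal_part X M \<in> U}"
      unfolding openR using B by (intro exI conjI)
  qed
  show "open_map (structure_space ?R) (structure_space ?S) (infinitesimal_part X)"
    unfolding open_map_def
  proof (intro allI impI)
    fix U assume "openin (structure_space ?R) U"
    then obtain A where A: "A \<subseteq> carrier ?R" and U: "U = {M. maximalideal M ?R \<and> \<not> A \<subseteq> M}"
      unfolding openR by (elim exE conjE)
    \<comment> \<open>The image of the closed set \<open>{M. A \<subseteq> M}\<close> will be cut out by all bounded functions that lie in
      \<open>\<mu>(M)\<close> for each of its points \<open>M\<close>; separation shows that no other point satisfies these conditions.\<close>
    define H where "H = {h \<in> carrier ?S. \<forall>M. maximalideal M ?R \<longrightarrow> A \<subseteq> M \<longrightarrow> h \<in> infinitesimal_part X M}"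
    have sub: "A \<subseteq> M \<longleftrightarrow> H \<subseteq> infinitesimal_part X M" if M: "maximalideal M ?R" for M
    proof
      assume "A \<subseteq> M"
      then show "H \<subseteq> infinitesimal_part X M" using M by (simp add: H_def subset_iff)
    next
      assume HM: "H \<subseteq> infinitesimal_part X M"
      show "A \<subseteq> M"
      proof (rule subsetI, rule ccontr)
        fix a assume a: "a \<in> A" "a \<notin> M"
        obtain h where h: "h \<in> carrier ?S" "h \<notin> infinitesimal_part X M"
          and sep: "\<And>N. maximalideal N ?R \<Longrightarrow> a \<in> N \<Longrightarrow> h \<in> infinitesimal_part X N"
          using infinitesimal_part_separation[OF M subsetD[OF A a(1)] a(2)] by metis
        have "h \<in> H" using h(1) sep a(1) by (simp add: H_def subset_iff)
        then show False using HM h(2) by blast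
      qed
    qed
    have "infinitesimal_part X ` U = {N. maximalideal N ?S \<and> \<not> H \<subseteq> N}"
    proof (intro equalityI subsetI)
      fix N assume "N \<in> infinitesimal_part X ` U"
      then obtain M where "maximalideal M ?R" "\<not> A \<subseteq> M" "N = infinitesimal_part X M"
        by (auto simp: U)
      then show "N \<in> {N. maximalideal N ?S \<and> \<not> H \<subseteq> N}"
        using sub maximalideal_infinitesimal_part by simp
    next
      fix N assume N: "N \<in> {N. maximalideal N ?S \<and> \<not> H \<subseteq> N}"
      then obtain M where "maximalideal M ?R" "infinitesimal_part X M = N"
        using infinitesimal_part_surj by (metis mem_Collect_eq)
      then show "N \<in> infinitesimal_part X ` U"
        using N sub by (intro image_eqI[of _ _ M]) (simp_all add: U)
    qed
    moreover have "H \<subseteq> carrier ?S" by (simp add: H_def subset_iff)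
    ultimately show "openin (structure_space ?S) (infinitesimal_part X ` U)"
      unfolding openS by (intro exI conjI)
  qed
qed

theorem corollary4p9:
  fixes X :: "'a topology"
  assumes "normal_space X" and "t1_space X"
  shows "structure_space (baire_one_ring X) homeomorphic_space
         structure_space (bounded_baire_one_ring X)"
  by (rule homeomorphic_map_imp_homeomorphic_space[OF homeomorphic_map_infinitesimal_part])

end
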